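(* Let $K$ be any field and $n\geq 1$. In the field $K(x_1,\ldots,x_n)$ of rational functions, let $e_k=\sum_{1\le i_1<\dots<i_k\le n}x_{i_1}\cdots x_{i_k}$ ($1\le k\le n$) be the elementary symmetric polynomials and $p_k=\sum_{i=1}^n x_i^k$ ($k\geq 1$) the power polynomials. Then $K(e_1,\ldots,e_n)=K(p_1,p_2,p_3,\ldots)$, where $K(S)$ denotes the subfield of $K(x_1,\ldots,x_n)$ generated over $K$ by the set $S$. *)

theory Defs
  imports
    "HOL-Library.Cardinality"
    "HOL-Library.Poly_Mapping"
    "HOL-Computational_Algebra.Fraction_Field"
    "HOL-Algebra.Generated_Fields"
    "HOL-Algebra.Algebraic_Closure_Type"
begin

text \<open>
  For a finite linearly ordered index type \<open>'n\<close>, the type \<open>('n, 'k) ratfun\<close> is the field of rational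
  functions over \<open>'k\<close> in the \<open>CARD('n)\<close> variables \<open>x\<^sub>i\<close>, \<open>i :: 'n\<close>: the fraction field of the polynomial
  ring \<open>('n \<Rightarrow>\<^sub>0 nat) \<Rightarrow>\<^sub>0 'k\<close>, whose elements map exponent vectors to coefficients.  The order on
  the indices is the order of \<open>1, \<dots>, n\<close>; the library also needs it to know that polynomials form
  an integral domain.
\<close>

type_synonym ('n, 'k) ratfun = "(('n \<Rightarrow>\<^sub>0 nat) \<Rightarrow>\<^sub>0 'k) fract"

definition const :: "'k \<Rightarrow> ('n::{finite,linorder}, 'k::field) ratfun"
  where "const c = Fract (Poly_Mapping.single 0 c) 1"

definition indet :: "'n \<Rightarrow> ('n::{finite,linorder}, 'k::field) ratfun"
  where "indet i = Fract (Poly_Mapping.single (Poly_Mapping.single i 1) 1) 1"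

text \<open>The index tuples \<open>i\<^sub>1 < \<dots> < i\<^sub>k\<close> are the same thing as the \<open>k\<close>-element sets of indices.\<close>

definition elem_sym :: "nat \<Rightarrow> ('n::{finite,linorder}, 'k::field) ratfun"
  where "elem_sym k = (\<Sum>I | card (I :: 'n set) = k. \<Prod>i\<in>I. indet i)"

definition power_sum :: "nat \<Rightarrow> ('n::{finite,linorder}, 'k::field) ratfun"
  where "power_sum k = (\<Sum>i\<in>(UNIV :: 'n set). indet i ^ k)"

text \<open>
  \<open>K(S)\<close>.  The term \<open>ring_of_type_algebra\<close> is the rational function field as a ring record, with all
  of \<open>('n, 'k) ratfun\<close> as its carrier.
\<close>

definition adjoin ::
    "('n::{finite,linorder}, 'k::field) ratfun set \<Rightarrow> ('n, 'k) ratfun set"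
  where "adjoin S = generate_field ring_of_type_algebra (range const \<union> S)"

end

theory Submission
  imports Defs "HOL-Analysis.Determinants"
begin

text \<open>
  Newton's identities express the power sums through the elementary symmetric polynomials, which gives
  one inclusion.  In positive characteristic they cannot be solved for the \<open>e\<^sub>k\<close>; but for the
  indices \<open>n + 1, \<dots>, 2 n\<close> they read \<open>\<Sum>j\<le>n. (-1)\<^sup>j e\<^sub>j p\<^bsub>n + m - j\<^esub> = 0\<close>, a linear system in
  \<open>e\<^sub>1, \<dots>, e\<^sub>n\<close> over the field generated by the power sums.  Its matrix is non-singular because the
  \<open>x\<^sub>i\<close> are distinct and nonzero, so the \<open>e\<^sub>k\<close> are rational in the power sums by Cramer's rule.
\<close>

no_notation fps_nth (infixl \<open>$\<close> 75)

section \<open>Newton's identities\<close>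

text \<open>Logarithmic differentiation: the factor \<open>1 - x i * X\<close> contributes
  \<open>- x i / (1 - x i * X)\<close>, a geometric series. Multiplying out by the product avoids
  dividing power series and allows induction on \<open>A\<close>.\<close>

lemma fps_deriv_prod_one_minus:
  fixes x :: "'i \<Rightarrow> 'a::field"
  assumes "finite A"
  shows "fps_deriv (\<Prod>i\<in>A. 1 - fps_const (x i) * fps_X) =
         - (\<Prod>i\<in>A. 1 - fps_const (x i) * fps_X) * Abs_fps (\<lambda>k. \<Sum>i\<in>A. x i ^ Suc k)"
  using assms
proof (induction A rule: finite_induct)
  case empty
  show ?case by (simp add: fps_eq_iff)
next
  case (insert a A)
  let ?l = "\<lambda>i. 1 - fps_const (x i) * fps_X"
  let ?P = "\<lambda>A. Abs_fps (\<lambda>k. \<Sum>i\<in>A. x i ^ Suc k)"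
  have split: "?P (insert a A) = Abs_fps (\<lambda>k. x a ^ Suc k) + ?P A"
    using insert by (simp add: fps_eq_iff)
  have geom: "?l a * Abs_fps (\<lambda>k. x a ^ Suc k) = fps_const (x a)"
  proof (rule fps_ext)
    fix k
    show "fps_nth (?l a * Abs_fps (\<lambda>k. x a ^ Suc k)) k = fps_nth (fps_const (x a)) k"
      by (cases k) (simp_all add: algebra_simps)
  qed
  have "fps_deriv (\<Prod>i\<in>insert a A. ?l i) = - fps_const (x a) * prod ?l A + ?l a * fps_deriv (prod ?l A)"
    using insert by (simp add: algebra_simps del: fps_const_neg)
  also have "\<dots> = - (?l a * Abs_fps (\<lambda>k. x a ^ Suc k)) * prod ?l A - ?l a * (prod ?l A * ?P A)"
    unfolding insert.IH geom by (simp add: algebra_simps)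
  also have "\<dots> = - (\<Prod>i\<in>insert a A. ?l i) * ?P (insert a A)"
    unfolding split using insert by (simp add: algebra_simps)
  finally show ?case .
qed

text \<open>Picking the term \<open>- x i * X\<close> from exactly the factors in \<open>I\<close>
  produces a monomial of degree \<open>card I\<close>.\<close>

lemma fps_nth_prod_one_minus:
  fixes x :: "'n::finite \<Rightarrow> 'a::field"
  shows "fps_nth (\<Prod>i\<in>UNIV. 1 - fps_const (x i) * fps_X) k =
         (-1) ^ k * (\<Sum>I | card I = k. \<Prod>i\<in>I. x i)"
proof -
  have const_prod: "(\<Prod>i\<in>I. fps_const (x i)) = fps_const (\<Prod>i\<in>I. x i)" for I
    by (induction I rule: infinite_finite_induct) auto
  have const_minus: "(-1 :: 'a fps) ^ m = fps_const ((-1) ^ m)" for m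
    by (metis fps_const_neg fps_const_power fps_const_1_eq_1)
  have expand: "(\<Prod>i\<in>UNIV. 1 - fps_const (x i) * fps_X) =
        (\<Sum>I\<in>Pow UNIV. fps_const ((-1) ^ card I * (\<Prod>i\<in>I. x i)) * fps_X ^ card I)"
    by (subst prod_diff_conv_sum)
       (auto simp: prod.distrib const_prod const_minus algebra_simps intro!: sum.cong)
  have "fps_nth (\<Prod>i\<in>UNIV. 1 - fps_const (x i) * fps_X) k =
        (\<Sum>I\<in>Pow UNIV. if card I = k then (-1) ^ k * (\<Prod>i\<in>I. x i) else 0)"
    unfolding expand fps_sum_nth by (intro sum.cong) auto
  also have "\<dots> = (-1) ^ k * (\<Sum>I | card I = k. \<Prod>i\<in>I. x i)"
    by (simp add: sum.If_cases sum_distrib_left)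
  finally show ?thesis .
qed

text \<open>Compare the coefficients of \<open>X ^ k\<close> in the logarithmic derivative formula.
  The factor \<open>of_nat (Suc k)\<close> may vanish in positive characteristic, so this cannot in
  general be solved for \<open>e (Suc k)\<close>.\<close>

lemma newton_identity:
  fixes x :: "'n::finite \<Rightarrow> 'a::field"
  defines "e \<equiv> \<lambda>k. \<Sum>I | card I = k. \<Prod>i\<in>I. x i"
  shows "of_nat (Suc k) * ((-1) ^ Suc k * e (Suc k)) =
         - (\<Sum>j\<le>k. (-1) ^ j * e j * (\<Sum>i\<in>UNIV. x i ^ (Suc k - j)))"
proof -
  let ?E = "\<Prod>i\<in>UNIV. 1 - fps_const (x i) * fps_X"
  have "of_nat (Suc k) * ((-1) ^ Suc k * e (Suc k)) = fps_nth (fps_deriv ?E) k"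
    by (simp add: fps_nth_prod_one_minus e_def)
  also have "\<dots> = - fps_nth (?E * Abs_fps (\<lambda>k. \<Sum>i\<in>UNIV. x i ^ Suc k)) k"
    by (subst fps_deriv_prod_one_minus) simp_all
  also have "\<dots> = - (\<Sum>j\<le>k. (-1) ^ j * e j * (\<Sum>i\<in>UNIV. x i ^ (Suc k - j)))"
    unfolding fps_mult_nth
    by (auto simp: fps_nth_prod_one_minus e_def Suc_diff_le atMost_atLeast0 intro!: sum.cong)
  finally show ?thesis .
qed

lemma sum_prod_card_zero:
  fixes x :: "'n::finite \<Rightarrow> 'a::field"
  shows "(\<Sum>I | card I = 0. \<Prod>i\<in>I. x i) = 1"
proof -
  have "{I :: 'n set. card I = 0} = {{}}" by auto
  then show ?thesis by simp
qed

lemma sum_prod_card_greater: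
  fixes x :: "'n::finite \<Rightarrow> 'a::field"
  assumes "k > CARD('n)"
  shows "(\<Sum>I | card I = k. \<Prod>i\<in>I. x i) = 0"
proof -
  have "card I \<noteq> k" for I :: "'n set"
    using card_mono[of UNIV I] assms by auto
  then show ?thesis by simp
qed

text \<open>This is Newton's identity at index \<open>CARD('n) + m\<close>: being above
  \<open>CARD('n)\<close>, it makes the left side vanish together with all terms for
  \<open>j > CARD('n)\<close>.\<close>

lemma power_sum_recurrence:
  fixes x :: "'n::finite \<Rightarrow> 'a::field"
  assumes "m \<ge> 1"
  shows "(\<Sum>j\<le>CARD('n). (-1) ^ j * (\<Sum>I | card I = j. \<Prod>i\<in>I. x i) *
           (\<Sum>i\<in>UNIV. x i ^ (CARD('n) + m - j))) = 0"
proof -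
  define k where "k = CARD('n) + m - 1"
  have k: "Suc k = CARD('n) + m" "CARD('n) \<le> k"
    using assms by (auto simp: k_def)
  have "(\<Sum>j\<le>CARD('n). (-1) ^ j * (\<Sum>I | card I = j. \<Prod>i\<in>I. x i) * (\<Sum>i\<in>UNIV. x i ^ (Suc k - j))) =
        (\<Sum>j\<le>k. (-1) ^ j * (\<Sum>I | card I = j. \<Prod>i\<in>I. x i) * (\<Sum>i\<in>UNIV. x i ^ (Suc k - j)))"
    using k by (intro sum.mono_neutral_left) (auto simp: sum_prod_card_greater)
  also have "\<dots> = - (of_nat (Suc k) * ((-1) ^ Suc k * (\<Sum>I | card I = Suc k. \<Prod>i\<in>I. x i)))"
    unfolding newton_identity by simp
  also have "\<dots> = 0"
    using k by (subst sum_prod_card_greater) auto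
  finally show ?thesis unfolding k .
qed

section \<open>Non-singularity of the linear system\<close>

text \<open>By linearity the sums stay zero when \<open>x i ^ m\<close> is replaced by
  \<open>poly r (x i)\<close> with \<open>degree r < CARD('n)\<close>. Suitable \<open>r\<close>
  give \<open>q\<close> the \<open>CARD('n)\<close> roots \<open>x i\<close>, too many for its
  degree.\<close>

lemma poly_eq_0_if_weighted_sums_0:
  fixes x :: "'n::finite \<Rightarrow> 'a::field"
  assumes inj: "inj x" and nz: "\<And>i. x i \<noteq> 0"
    and deg: "degree q < CARD('n)"
    and sums: "\<And>m. m < CARD('n) \<Longrightarrow> (\<Sum>i\<in>UNIV. x i ^ Suc m * poly q (x i)) = 0"
  shows "q = 0"
proof (rule poly_eqI_degree[of "range x"])
  fix y assume "y \<in> range x"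
  then obtain i where y: "y = x i" by auto
  \<comment> \<open>Testing against \<open>r\<close>, which vanishes at all \<open>x\<^sub>j\<close> but \<open>x\<^sub>i\<close>, isolates one summand.\<close>
  define r where "r = (\<Prod>j\<in>UNIV - {i}. [:- x j, 1:])"
  have deg_r: "degree r < CARD('n)"
    unfolding r_def by (subst degree_prod_sum_eq) (auto simp: card_Diff_singleton)
  have r_zero: "poly r (x j) = 0" if "j \<noteq> i" for j
    using that by (auto simp: r_def poly_prod)
  have r_nz: "poly r (x i) \<noteq> 0"
    using inj by (auto simp: r_def poly_prod inj_def)
  have "(\<Sum>j\<in>UNIV. poly r (x j) * (x j * poly q (x j))) =
        (\<Sum>j\<in>UNIV. \<Sum>m\<le>degree r. coeff r m * (x j ^ Suc m * poly q (x j)))"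
    by (simp add: poly_altdef[of r] sum_distrib_right sum_distrib_left mult_ac)
  also have "\<dots> = (\<Sum>m\<le>degree r. coeff r m * (\<Sum>j\<in>UNIV. x j ^ Suc m * poly q (x j)))"
    by (subst sum.swap) (simp only: sum_distrib_left)
  also have "\<dots> = 0"
    using deg_r by (intro sum.neutral) (auto simp: sums simp del: power_Suc)
  finally have "(\<Sum>j\<in>UNIV. poly r (x j) * (x j * poly q (x j))) = 0" .
  moreover have "(\<Sum>j\<in>UNIV. poly r (x j) * (x j * poly q (x j))) = poly r (x i) * (x i * poly q (x i))"
    by (subst sum.remove[of _ i]) (auto simp: r_zero intro!: sum.neutral)
  ultimately show "poly q y = poly 0 y"
    using r_nz nz y by simp
qed (use deg inj in \<open>auto simp: card_image\<close>)

text \<open>A kernel vector becomes the coefficients of a polynomial \<open>q\<close>, and each row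
  a weighted sum of its values at the \<open>x i\<close>. The bijection \<open>h\<close> numbers the
  rows and columns, which are indexed by \<open>'n\<close> itself.\<close>

lemma det_power_sum_matrix_nonzero:
  fixes x :: "'n::finite \<Rightarrow> 'a::field" and h :: "'n \<Rightarrow> nat"
  assumes inj: "inj x" and nz: "\<And>i. x i \<noteq> 0" and h: "bij_betw h UNIV {1..CARD('n)}"
  shows "det (\<chi> r c. \<Sum>i\<in>UNIV. x i ^ (CARD('n) + h r - h c)) \<noteq> 0"
proof -
  let ?A = "\<chi> r c. \<Sum>i\<in>UNIV. x i ^ (CARD('n) + h r - h c)"
  have h_range: "1 \<le> h c" "h c \<le> CARD('n)" for c
    using bij_betwE[OF h] by auto
  have "z = 0" if ker: "?A *v z = 0" for z :: "'a ^ 'n"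
  proof -
    \<comment> \<open>The exponents run through \<open>0\<close> to \<open>CARD('n) - 1\<close>, and
      \<open>x i ^ (CARD('n) + h r - h c)\<close> splits off \<open>x i ^ h r\<close>.\<close>
    define q where "q = (\<Sum>c\<in>UNIV. monom (z $ c) (CARD('n) - h c))"
    have "q = 0"
    proof (rule poly_eq_0_if_weighted_sums_0[OF inj nz])
      show "degree q < CARD('n)"
        unfolding q_def using h_range
        by (intro degree_sum_less) (auto simp: Suc_le_eq intro!: le_less_trans[OF degree_monom_le] diff_less)
    next
      fix m assume "m < CARD('n)"
      then have "Suc m \<in> h ` UNIV"
        using h by (auto simp: bij_betw_def)
      then obtain r where r: "h r = Suc m" by auto
      have "0 = (?A *v z) $ r" using ker by simp
      also have "\<dots> = (\<Sum>c\<in>UNIV. \<Sum>i\<in>UNIV. x i ^ (CARD('n) + h r - h c) * z $ c)"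
        by (simp add: matrix_vector_mult_def sum_distrib_right)
      also have "\<dots> = (\<Sum>c\<in>UNIV. \<Sum>i\<in>UNIV. x i ^ h r * (z $ c * x i ^ (CARD('n) - h c)))"
        using h_range by (intro sum.cong) (auto simp: power_add[symmetric] algebra_simps)
      also have "\<dots> = (\<Sum>i\<in>UNIV. x i ^ Suc m * poly q (x i))"
        unfolding r by (subst sum.swap)
          (simp add: q_def poly_sum poly_monom sum_distrib_left)
      finally show "(\<Sum>i\<in>UNIV. x i ^ Suc m * poly q (x i)) = 0" by simp
    qed
    have "z $ c = 0" for c
    proof -
      \<comment> \<open>Distinct columns give distinct monomials, so every entry of \<open>z\<close>
        is a coefficient of \<open>q\<close>; \<open>h d \<le> CARD('n)\<close> keeps the natural
        subtraction from truncating.\<close>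
      have "CARD('n) - h d = CARD('n) - h c \<longleftrightarrow> d = c" for d
        using h_range[of c] h_range[of d] h by (auto simp: bij_betw_def inj_def)
      then have "coeff q (CARD('n) - h c) = z $ c"
        by (simp add: q_def coeff_sum)
      then show ?thesis using \<open>q = 0\<close> by simp
    qed
    then show ?thesis by (simp add: vec_eq_iff)
  qed
  then show ?thesis
    unfolding invertible_det_nz[symmetric] invertible_left_inverse matrix_left_invertible_ker by blast
qed

section \<open>Subfields of a field type\<close>

text \<open>Subfields are phrased with the type class operations, so that sums, determinants and
  Cramer's rule for types apply directly.\<close>

locale field_subset =
  fixes F :: "'a::field set"
  assumes one_mem: "1 \<in> F"
    and uminus_mem: "a \<in> F \<Longrightarrow> - a \<in> F"
    and inverse_mem: "a \<in> F \<Longrightarrow> inverse a \<in> F"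
    and add_mem: "a \<in> F \<Longrightarrow> b \<in> F \<Longrightarrow> a + b \<in> F"
    and mult_mem: "a \<in> F \<Longrightarrow> b \<in> F \<Longrightarrow> a * b \<in> F"
begin

lemma zero_mem: "0 \<in> F"
  using add_mem[OF one_mem uminus_mem[OF one_mem]] by simp

lemma diff_mem: "a \<in> F \<Longrightarrow> b \<in> F \<Longrightarrow> a - b \<in> F"
  using add_mem[OF _ uminus_mem] by fastforce

lemma divide_mem: "a \<in> F \<Longrightarrow> b \<in> F \<Longrightarrow> a / b \<in> F"
  by (simp add: divide_inverse inverse_mem mult_mem)

lemma sum_mem: "(\<And>i. i \<in> A \<Longrightarrow> f i \<in> F) \<Longrightarrow> sum f A \<in> F"
  by (induction A rule: infinite_finite_induct) (auto simp: zero_mem add_mem)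

lemma prod_mem: "(\<And>i. i \<in> A \<Longrightarrow> f i \<in> F) \<Longrightarrow> prod f A \<in> F"
  by (induction A rule: infinite_finite_induct) (auto simp: one_mem mult_mem)

lemma of_nat_mem: "of_nat k \<in> F"
  by (induction k) (auto simp: zero_mem one_mem add_mem)

lemma sign_power_mult_mem: "(-1) ^ k * a \<in> F \<longleftrightarrow> a \<in> F"
  using uminus_mem[of a] uminus_mem[of "- a"] by (cases "even k") auto

lemma det_mem:
  fixes A :: "'a ^ 'n ^ 'n"
  assumes "\<And>i j. A $ i $ j \<in> F"
  shows "det A \<in> F"
  unfolding det_def
  by (intro sum_mem mult_mem prod_mem assms) (auto simp: sign_def one_mem uminus_mem)

text \<open>Cramer's rule writes each coordinate as a quotient of two determinants with entries in
  \<open>F\<close>.\<close>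

lemma linear_system_solution_mem:
  fixes A :: "'a ^ 'n ^ 'n"
  assumes "A *v y = b" "det A \<noteq> 0"
    and "\<And>i j. A $ i $ j \<in> F" "\<And>i. b $ i \<in> F"
  shows "y $ i \<in> F"
proof -
  have "y = (\<chi> k. det (\<chi> i j. if j = k then b $ i else A $ i $ j) / det A)"
    using cramer[OF assms(2)] assms(1) by blast
  then have "y $ i = det (\<chi> r j. if j = i then b $ r else A $ r $ j) / det A"
    by (simp add: vec_eq_iff)
  then show ?thesis
    using assms by (auto intro!: divide_mem det_mem)
qed

text \<open>In Newton's identity \<open>p k\<close> occurs with coefficient \<open>e 0 = 1\<close>,
  so strong induction works in every characteristic.\<close>

lemma power_sum_mem:
  fixes x :: "'n::finite \<Rightarrow> 'a"
  assumes "\<And>k. k \<in> {1..CARD('n)} \<Longrightarrow> (\<Sum>I | card I = k. \<Prod>i\<in>I. x i) \<in> F"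
    and "k \<ge> 1"
  shows "(\<Sum>i\<in>UNIV. x i ^ k) \<in> F"
  using assms(2)
proof (induction k rule: less_induct)
  case (less k)
  define e where "e j = (\<Sum>I | card I = j. \<Prod>i\<in>I. x i)" for j
  define p where "p j = (\<Sum>i\<in>UNIV. x i ^ j)" for j
  have e_mem: "e j \<in> F" for j
    using assms(1)[of j] sum_prod_card_zero[of x] sum_prod_card_greater[of j x] zero_mem one_mem
    by (cases "j = 0"; cases "j > CARD('n)") (auto simp: e_def)
  obtain l where l: "k = Suc l" using less.prems by (cases k) auto
  have "of_nat k * ((-1) ^ k * e k) = - (\<Sum>j\<le>l. (-1) ^ j * e j * p (k - j))"
    unfolding e_def p_def l by (rule newton_identity)
  also have "(\<Sum>j\<le>l. (-1) ^ j * e j * p (k - j)) = p k + (\<Sum>j\<in>{1..l}. (-1) ^ j * e j * p (k - j))"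
    by (simp add: atMost_atLeast0 sum.atLeast_Suc_atMost e_def sum_prod_card_zero)
  finally have "p k = - (of_nat k * ((-1) ^ k * e k)) - (\<Sum>j\<in>{1..l}. (-1) ^ j * (e j * p (k - j)))"
    by (simp add: mult.assoc)
  moreover have "p (k - j) \<in> F" if "j \<in> {1..l}" for j
    unfolding p_def using that l by (intro less.IH) auto
  ultimately have "p k \<in> F"
    by (auto intro!: diff_mem uminus_mem sum_mem mult_mem of_nat_mem e_mem
        simp: sign_power_mult_mem[of _ 1, simplified] one_mem)
  then show ?case by (simp add: p_def)
qed

text \<open>The signed values \<open>a j\<close> solve the system given by the recurrences for
  \<open>m = h r\<close>, once the term \<open>j = 0\<close> is moved to the right-hand
  side.\<close>

lemma elem_sym_mem:
  fixes x :: "'n::finite \<Rightarrow> 'a"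
  assumes inj: "inj x" and nz: "\<And>i. x i \<noteq> 0"
    and p_mem: "\<And>k. k \<ge> 1 \<Longrightarrow> (\<Sum>i\<in>UNIV. x i ^ k) \<in> F"
    and k: "k \<in> {1..CARD('n)}"
  shows "(\<Sum>I | card I = k. \<Prod>i\<in>I. x i) \<in> F"
proof -
  define a where "a j = (-1) ^ j * (\<Sum>I | card I = j. \<Prod>i\<in>I. x i)" for j
  define p where "p j = (\<Sum>i\<in>UNIV. x i ^ j)" for j
  have "\<exists>h. bij_betw h (UNIV :: 'n set) {1..CARD('n)}"
    by (rule finite_same_card_bij) auto
  then obtain h :: "'n \<Rightarrow> nat" where h: "bij_betw h UNIV {1..CARD('n)}" by blast
  have h_range: "1 \<le> h c" "h c \<le> CARD('n)" for c
    using bij_betwE[OF h] by auto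
  let ?A = "\<chi> r c. p (CARD('n) + h r - h c)"
  have "(\<Sum>c\<in>UNIV. p (CARD('n) + h r - h c) * a (h c)) = - p (CARD('n) + h r)" for r
  proof -
    have "(\<Sum>c\<in>UNIV. p (CARD('n) + h r - h c) * a (h c)) =
          (\<Sum>j\<in>{1..CARD('n)}. a j * p (CARD('n) + h r - j))"
      by (subst sum.reindex_bij_betw[OF h, symmetric]) (simp add: mult.commute)
    moreover have "(\<Sum>j\<le>CARD('n). a j * p (CARD('n) + h r - j)) = 0"
      using power_sum_recurrence[OF h_range(1)] by (simp add: a_def p_def)
    moreover have "(\<Sum>j\<le>CARD('n). a j * p (CARD('n) + h r - j)) =
        p (CARD('n) + h r) + (\<Sum>j\<in>{1..CARD('n)}. a j * p (CARD('n) + h r - j))"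
      by (simp add: atMost_atLeast0 sum.atLeast_Suc_atMost a_def sum_prod_card_zero)
    ultimately show ?thesis by (simp add: eq_neg_iff_add_eq_0 add.commute)
  qed
  then have "?A *v (\<chi> c. a (h c)) = (\<chi> r. - p (CARD('n) + h r))"
    by (simp add: matrix_vector_mult_def vec_eq_iff)
  moreover have "det ?A \<noteq> 0"
    unfolding p_def by (rule det_power_sum_matrix_nonzero[OF inj nz h])
  moreover have "p j \<in> F" if "j \<ge> 1" for j
    using p_mem that by (simp add: p_def)
  then have "?A $ r $ c \<in> F" "(\<chi> r. - p (CARD('n) + h r)) $ r \<in> F" for r c
    using h_range[of r] h_range[of c] by (auto intro!: uminus_mem)
  ultimately have "(\<chi> c. a (h c)) $ c \<in> F" for c
    by (rule linear_system_solution_mem)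
  moreover obtain c where "h c = k"
    using h k by (metis bij_betw_iff_bijections)
  ultimately have "a k \<in> F" by auto
  then show ?thesis by (simp add: a_def sign_power_mult_mem)
qed

end

section \<open>Rational functions\<close>

lemma m_inv_ring_of_type_algebra:
  fixes a :: "'a::field"
  assumes "a \<noteq> 0"
  shows "m_inv ring_of_type_algebra a = inverse a"
proof -
  interpret R: field "ring_of_type_algebra :: 'a ring" by (rule field_from_type_algebra)
  show ?thesis
    by (rule R.inv_unique'[symmetric]) (use assms in \<open>auto simp: ring_of_type_algebra_def\<close>)
qed

lemma a_inv_ring_of_type_algebra: "a_inv ring_of_type_algebra a = - (a :: 'a::field)"
proof -
  interpret R: field "ring_of_type_algebra :: 'a ring" by (rule field_from_type_algebra)
  show ?thesis
    by (rule R.minus_equality) (auto simp: ring_of_type_algebra_def)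
qed

lemma field_subset_generate_field:
  "field_subset (generate_field ring_of_type_algebra (S :: 'a::field set))"
proof -
  let ?R = "ring_of_type_algebra :: 'a ring"
  note ops = ring_of_type_algebra_def
  have one: "1 \<in> generate_field ?R S"
    using generate_field.one[of ?R S] by (simp add: ops)
  have uminus: "- a \<in> generate_field ?R S" if "a \<in> generate_field ?R S" for a
    using generate_field.a_inv[OF that] by (simp add: a_inv_ring_of_type_algebra)
  have add: "a + b \<in> generate_field ?R S" if "a \<in> generate_field ?R S" "b \<in> generate_field ?R S" for a b
    using generate_field.eng_add[OF that] by (simp add: ops)
  have "a * b \<in> generate_field ?R S" if "a \<in> generate_field ?R S" "b \<in> generate_field ?R S" for a b
    using generate_field.eng_mult[OF that] by (simp add: ops)
  moreover have "inverse a \<in> generate_field ?R S" if "a \<in> generate_field ?R S" for a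
  \<comment> \<open>Generation closes only under inverses of nonzero elements; at zero the
    convention \<open>inverse 0 = 0\<close> settles the claim.\<close>
  proof (cases "a = 0")
    case False
    then show ?thesis
      using generate_field.m_inv[OF that] m_inv_ring_of_type_algebra[of a] by (simp add: ops)
  qed (use that in simp)
  ultimately show ?thesis
    using one uminus add by unfold_locales
qed

lemma generate_field_minimal:
  assumes "S \<subseteq> generate_field R T"
  shows "generate_field R S \<subseteq> generate_field R T"
proof
  fix a assume "a \<in> generate_field R S"
  then show "a \<in> generate_field R T"
    by induction (use assms in \<open>auto intro: generate_field.intros\<close>)
qed

text \<open>The constants already lie in \<open>adjoin T\<close>, so only the generators in
  \<open>S\<close> matter.\<close>

lemma adjoin_subset_adjoin:
  assumes "S \<subseteq> adjoin T"
  shows "adjoin S \<subseteq> adjoin T"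
  using assms unfolding adjoin_def
  by (intro generate_field_minimal) (auto intro: generate_field.incl)

lemma field_subset_adjoin: "field_subset (adjoin S)"
  unfolding adjoin_def by (rule field_subset_generate_field)

lemma subset_adjoin: "S \<subseteq> adjoin S"
  unfolding adjoin_def by (auto intro: generate_field.incl)

text \<open>With \<open>indet_nonzero\<close>, this makes the indeterminates admissible as
  \<open>x\<close> in \<open>elem_sym_mem\<close>.\<close>

lemma inj_indet: "inj (indet :: 'n::{finite,linorder} \<Rightarrow> ('n, 'k::field) ratfun)"
proof (rule injI)
  fix i j :: 'n
  assume "indet i = (indet j :: ('n, 'k) ratfun)"
  then have "Poly_Mapping.single (Poly_Mapping.single i (1::nat)) (1::'k) =
             Poly_Mapping.single (Poly_Mapping.single j 1) 1"
    by (simp add: indet_def eq_fract)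
  then have "Poly_Mapping.single i (1::nat) = Poly_Mapping.single j 1"
    by (metis lookup_single_eq lookup_single_not_eq zero_neq_one)
  then show "i = j"
    by (metis lookup_single_eq lookup_single_not_eq zero_neq_one)
qed

lemma indet_nonzero: "indet i \<noteq> 0"
  by (simp add: indet_def Zero_fract_def eq_fract)
     (metis lookup_single_eq lookup_zero zero_neq_one)

theorem theorem1p3:
  shows "adjoin (elem_sym ` {1..CARD('n)}) =
         (adjoin (power_sum ` {1..}) :: ('n::{finite,linorder}, 'k::field) ratfun set)"
proof (intro equalityI adjoin_subset_adjoin)
  let ?Fe = "adjoin (elem_sym ` {1..CARD('n)}) :: ('n, 'k) ratfun set"
  let ?Fp = "adjoin (power_sum ` {1..}) :: ('n, 'k) ratfun set"
  have "power_sum k \<in> ?Fp" if "k \<ge> 1" for k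
    using that subset_adjoin[of "power_sum ` {1..} :: ('n, 'k) ratfun set"] by auto
  then show "elem_sym ` {1..CARD('n)} \<subseteq> ?Fp"
    using field_subset.elem_sym_mem[OF field_subset_adjoin inj_indet indet_nonzero]
    unfolding elem_sym_def power_sum_def by blast
  have "elem_sym k \<in> ?Fe" if "k \<in> {1..CARD('n)}" for k
    using that subset_adjoin[of "elem_sym ` {1..CARD('n)} :: ('n, 'k) ratfun set"] by auto
  then show "power_sum ` {1..} \<subseteq> ?Fe"
    using field_subset.power_sum_mem[OF field_subset_adjoin]
    unfolding elem_sym_def power_sum_def by blast
qed

end
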